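(* For every $M\in\mathbb N$, the probability that $\frac{a}{M}$, with $a\in\mathbb Z$ and $\gcd(a,M)=1$, has finite order equals $1$; that is, $$\sum_{n=0}^{\infty}\frac{A(n,M)}{\varphi(M^{n+1})}=1.$$
   Context: Let $\chi:\mathbb Q\to\mathbb Q$ be defined by $\chi(x)=x\lceil x\rceil$, where $\lceil x\rceil$ is the smallest integer greater than or equal to $x$. For $x\in\mathbb Q$, $\mathrm{ord}(x)=\min\{k\in\mathbb N_0:\chi^k(x)\in\mathbb Z\}$ if this set is nonempty, and $\mathrm{ord}(x)=\infty$ otherwise ($\mathbb N=\{1,2,\dots\}$, $\mathbb N_0=\mathbb N\cup\{0\}$). For $n\in\mathbb N_0$ and $M\in\mathbb N$, let $\mathcal A_{n,M}=\{a\in\mathbb Z:\gcd(a,M)=1,\ \mathrm{ord}(a/M)=n\}$; this set is a union of congruence classes modulo $M^{n+1}$, and $A(n,M)$ denotes the number of congruence classes modulo $M^{n+1}$ contained in $\mathcal A_{n,M}$. Thus $A(n,M)/\varphi(M^{n+1})$ is the proportion of residue classes modulo $M^{n+1}$ coprime to $M$ whose elements $a$ satisfy $\mathrm{ord}(a/M)=n$, interpreted as the probability that $a/M$ (with $\gcd(a,M)=1$) has order $n$. $\varphi$ is Euler's totient function. *)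

theory Defs
  imports Complex_Main "HOL-Library.Extended_Nat" "HOL-Number_Theory.Number_Theory"
begin

definition chi :: "rat \<Rightarrow> rat" where
  "chi x = x * of_int \<lceil>x\<rceil>"

definition chi_ord :: "rat \<Rightarrow> enat" where
  "chi_ord x = (if \<exists>k. (chi ^^ k) x \<in> \<int> then enat (LEAST k. (chi ^^ k) x \<in> \<int>) else \<infinity>)"

definition ord_set :: "nat \<Rightarrow> nat \<Rightarrow> int set" where
  "ord_set n M = {a. coprime a (int M) \<and> chi_ord (of_int a / of_nat M) = enat n}"

definition cong_class :: "nat \<Rightarrow> int \<Rightarrow> int set" where
  "cong_class m r = {b. [b = r] (mod int m)}"

definition class_count :: "nat \<Rightarrow> nat \<Rightarrow> nat" where
  "class_count n M = card {C \<in> range (cong_class (M ^ (n + 1))). C \<subseteq> ord_set n M}"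

end

theory Submission
  imports Defs
begin

text \<open>Write \<open>a = c M - s\<close> with \<open>c = \<lceil>a/M\<rceil>\<close> and \<open>0 \<le> s < M\<close>, and let \<open>c = g e\<close>, \<open>M = g d\<close> with
  \<open>g = gcd(c, M)\<close>. Then \<open>\<chi>(a/M) = e (g e M - s) / d\<close>. For fixed \<open>s\<close> and \<open>d\<close> the map
  \<open>e \<mapsto> e (g e M - s)\<close> permutes the residues modulo every power of \<open>d\<close>, so the new numerator is
  again uniformly distributed among the units. The denominators thus form a Markov chain on the
  divisors of \<open>M\<close> that moves from \<open>M\<close> to \<open>d\<close> with probability \<open>\<phi>(d)/M\<close>. Since \<open>\<phi>(M)/M < 1\<close> for
  \<open>M > 1\<close>, it is absorbed at \<open>1\<close> almost surely.\<close>

section \<open>Counting residues in periodic sets\<close>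

definition periodic :: "nat \<Rightarrow> int set \<Rightarrow> bool" where
  "periodic m S \<longleftrightarrow> (\<forall>a b. [a = b] (mod int m) \<longrightarrow> (a \<in> S \<longleftrightarrow> b \<in> S))"

definition residue_count :: "nat \<Rightarrow> int set \<Rightarrow> nat" where
  "residue_count m S = card {x \<in> {0..<int m}. x \<in> S}"

lemma periodicD: "periodic m S \<Longrightarrow> [a = b] (mod int m) \<Longrightarrow> a \<in> S \<longleftrightarrow> b \<in> S"
  by (auto simp: periodic_def)

lemma periodic_dvd: "periodic m S \<Longrightarrow> m dvd n \<Longrightarrow> periodic n S"
  unfolding periodic_def by (meson cong_dvd_modulus of_nat_dvd_iff)

lemma periodic_vimage:
  assumes "periodic m S" "\<And>a b. [a = b] (mod int m) \<Longrightarrow> [f a = f b] (mod int m)"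
  shows "periodic m (f -` S)"
  using assms by (simp add: periodic_def)

lemma periodic_coprime: "periodic m {x. coprime x (int m)}"
  unfolding periodic_def using cong_imp_coprime cong_sym by blast

lemma card_complete_residue_system:
  assumes "periodic m S" "finite X" "card X = m" and inj: "inj_on (\<lambda>x. f x mod int m) X"
  shows "card {x \<in> X. f x \<in> S} = residue_count m S"
proof -
  let ?r = "\<lambda>x. f x mod int m"
  have image: "?r ` X = {0..<int m}"
  proof (rule card_subset_eq)
    show "?r ` X \<subseteq> {0..<int m}"
      using assms(2,3) by (cases "m = 0") auto
    show "card (?r ` X) = card {0..<int m}"
      using assms(3) inj by (simp add: card_image)
  qed simp
  have "residue_count m S = card (?r ` {x \<in> X. ?r x \<in> S})"
    unfolding residue_count_def image[symmetric] Compr_image_eq ..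
  also have "\<dots> = card {x \<in> X. ?r x \<in> S}"
    using inj by (intro card_image) (auto simp: inj_on_def)
  also have "\<dots> = card {x \<in> X. f x \<in> S}"
    using periodicD[OF assms(1) cong_mod_leftI[OF cong_refl]] by simp
  finally show ?thesis ..
qed

lemma residue_count_vimage:
  assumes "periodic m S" and inj: "\<And>x y. [f x = f y] (mod int m) \<Longrightarrow> [x = y] (mod int m)"
  shows "residue_count m (f -` S) = residue_count m S"
proof -
  have "inj_on (\<lambda>x. f x mod int m) {0..<int m}"
  proof (rule inj_onI)
    fix x y assume xy: "x \<in> {0..<int m}" "y \<in> {0..<int m}" "f x mod int m = f y mod int m"
    have "[x = y] (mod int m)"
      by (rule inj) (simp add: cong_def xy(3))
    then show "x = y"
      using xy(1,2) by (intro cong_less_imp_eq_int[of _ "int m"]) auto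
  qed
  then have "card {x \<in> {0..<int m}. f x \<in> S} = residue_count m S"
    by (intro card_complete_residue_system assms(1)) simp_all
  then show ?thesis by (simp add: residue_count_def)
qed

lemma residue_count_coprime: "residue_count m {x. coprime x (int m)} = totient m"
proof -
  have "inj_on (\<lambda>x. int x mod int m) {0<..m}"
  proof (rule inj_onI)
    fix x y assume xy: "x \<in> {0<..m}" "y \<in> {0<..m}" "int x mod int m = int y mod int m"
    have "[int m - int x = int m - int y] (mod int m)"
      using xy(3) by (intro cong_diff cong_refl) (simp add: cong_def)
    then have "int m - int x = int m - int y"
      using xy(1,2) by (intro cong_less_imp_eq_int[of _ "int m"]) auto
    then show "x = y" by simp
  qed
  then have "card {x \<in> {0<..m}. int x \<in> {x. coprime x (int m)}} =
      residue_count m {x. coprime x (int m)}"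
    by (intro card_complete_residue_system periodic_coprime) auto
  then show ?thesis by (simp add: totient_def totatives_def)
qed

lemma residue_count_eq_sum_blocks:
  assumes "periodic (m * t) S"
  shows "residue_count (m * t) S = (\<Sum>s = 0..<int m. card {c \<in> {0..<int t}. c * int m - s \<in> S})"
proof -
  let ?X = "{0..<int m} \<times> {0..<int t}" and ?f = "\<lambda>(s, c). c * int m - s"
  have "inj_on (\<lambda>x. ?f x mod int (m * t)) ?X"
  proof (rule inj_onI, clarify)
    fix s c s' c'
    assume s: "s \<in> {0..<int m}" "s' \<in> {0..<int m}" and c: "c \<in> {0..<int t}" "c' \<in> {0..<int t}"
      and "(c * int m - s) mod int (m * t) = (c' * int m - s') mod int (m * t)"
    then have cong: "[c * int m - s = c' * int m - s'] (mod int m * int t)"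
      by (simp add: cong_def)
    then have "[c * int m - s = c' * int m - s'] (mod int m)"
      by (rule cong_modulus_mult)
    moreover have "[c * int m - s = 0 - s] (mod int m)" for c s
      by (intro cong_diff) (simp_all add: cong_0_iff)
    ultimately have "[s = s'] (mod int m)"
      by (metis cong_minus_minus_iff cong_sym cong_trans diff_0)
    then have s_eq: "s = s'"
      using s by (intro cong_less_imp_eq_int[of _ "int m"]) auto
    have "[c = c'] (mod int t)"
      using cong s by (simp add: s_eq cong_iff_dvd_diff flip: left_diff_distrib)
    then have "c = c'"
      using c by (intro cong_less_imp_eq_int[of _ "int t"]) auto
    with s_eq show "s = s' \<and> c = c'" ..
  qed
  then have "residue_count (m * t) S = card {x \<in> ?X. ?f x \<in> S}"
    by (intro card_complete_residue_system[symmetric] assms) auto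
  also have "{x \<in> ?X. ?f x \<in> S} = (SIGMA s:{0..<int m}. {c \<in> {0..<int t}. c * int m - s \<in> S})"
    by auto
  finally show ?thesis
    by (simp del: atLeastLessThan_iff)
qed

lemma residue_count_mult:
  assumes "periodic m S"
  shows "residue_count (m * t) S = t * residue_count m S"
proof -
  have "c * int m - s \<in> S \<longleftrightarrow> - s \<in> S" for c s
    by (rule periodicD[OF assms]) (simp add: cong_iff_dvd_diff)
  then have "card {c \<in> {0..<int t}. c * int m - s \<in> S} = (if - s \<in> S then t else 0)" for s
    by (simp del: atLeastLessThan_iff)
  then have "residue_count (m * t) S = (\<Sum>s = 0..<int m. if - s \<in> S then t else 0)"
    using residue_count_eq_sum_blocks[OF periodic_dvd[OF assms, of "m * t"]] by simp
  also have "\<dots> = t * card {s \<in> {0..<int m}. - s \<in> S}"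
    by (subst sum.inter_filter[symmetric]) simp_all
  also have "card {s \<in> {0..<int m}. - s \<in> S} = residue_count m (uminus -` S)"
    by (simp add: residue_count_def)
  also have "\<dots> = residue_count m S"
    using assms by (rule residue_count_vimage) (simp only: cong_minus_minus_iff)
  finally show ?thesis .
qed

lemma card_cong_classes_subset:
  assumes "periodic m S" "m > 0"
  shows "card {C \<in> range (cong_class m). C \<subseteq> S} = residue_count m S"
proof -
  have class_eq: "cong_class m x = cong_class m y \<longleftrightarrow> [x = y] (mod int m)" for x y
    unfolding cong_class_def by (auto simp: cong_def)
  have class_subset: "cong_class m x \<subseteq> S \<longleftrightarrow> x \<in> S" for x
    using periodicD[OF assms(1)] unfolding cong_class_def by (auto simp: cong_sym_eq)
  have "cong_class m x \<in> cong_class m ` {0..<int m}" for x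
    using assms(2) class_eq by (intro image_eqI[of _ _ "x mod int m"]) (auto simp: cong_def)
  then have "range (cong_class m) = cong_class m ` {0..<int m}"
    by blast
  then have "{C \<in> range (cong_class m). C \<subseteq> S} = cong_class m ` {x \<in> {0..<int m}. x \<in> S}"
    using class_subset by (simp only:) blast
  moreover have "inj_on (cong_class m) {x \<in> {0..<int m}. x \<in> S}"
    by (intro inj_onI cong_less_imp_eq_int[of _ "int m"]) (auto simp: class_eq)
  ultimately show ?thesis by (simp add: card_image residue_count_def)
qed

lemma card_gcd_eq_fibre:
  fixes P :: "int \<Rightarrow> bool"
  assumes "g > 0"
  shows "card {c \<in> {0..<int (g * l)}. P c \<and> gcd c (int (g * d)) = int g} =
    card {e \<in> {0..<int l}. coprime e (int d) \<and> P (int g * e)}" (is "card ?C = card ?E")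
proof -
  have "?C = (*) (int g) ` ?E"
  proof (intro equalityI subsetI)
    fix c assume "c \<in> ?C"
    moreover from this obtain e where "c = int g * e"
      by (metis (mono_tags) dvdE gcd_dvd1 mem_Collect_eq)
    ultimately show "c \<in> (*) (int g) ` ?E"
      using assms by (auto simp: gcd_mult_left zero_le_mult_iff coprime_iff_gcd_eq_1)
  qed (use assms in \<open>auto simp: gcd_mult_left coprime_iff_gcd_eq_1\<close>)
  then show ?thesis
    using assms by (simp add: card_image inj_on_def)
qed

lemma card_eq_sum_gcd:
  fixes P :: "int \<Rightarrow> bool"
  assumes "M > 0" "M dvd N"
  shows "card {c \<in> {0..<int N}. P c} = (\<Sum>d | d dvd M.
    card {e \<in> {0..<int (N div (M div d))}. coprime e (int d) \<and> P (int (M div d) * e)})"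
    (is "_ = (\<Sum>d | d dvd M. ?n d)")
proof -
  let ?C = "\<lambda>g. {c \<in> {0..<int N}. P c \<and> gcd c (int M) = int g}"
  have "{c \<in> {0..<int N}. P c} = (\<Union>g\<in>{g. g dvd M}. ?C g)"
  proof (intro equalityI subsetI)
    fix c assume "c \<in> {c \<in> {0..<int N}. P c}"
    moreover have "nat (gcd c (int M)) dvd M" by (simp add: nat_dvd_iff)
    ultimately show "c \<in> (\<Union>g\<in>{g. g dvd M}. ?C g)"
      by (intro UN_I[of "nat (gcd c (int M))"]) auto
  qed auto
  then have "card {c \<in> {0..<int N}. P c} = card (\<Union>g\<in>{g. g dvd M}. ?C g)"
    by (rule arg_cong)
  also have "\<dots> = (\<Sum>g | g dvd M. card (?C g))"
  proof (rule card_UN_disjoint)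
    show "\<forall>g\<in>{g. g dvd M}. finite (?C g)"
      by (simp del: atLeastLessThan_iff)
  qed (use assms(1) in auto)
  also have "\<dots> = (\<Sum>g | g dvd M. ?n (M div g))"
  proof (intro sum.cong refl)
    fix g assume "g \<in> {g. g dvd M}"
    then obtain d l where "M = g * d" "N = g * l"
      using \<open>M dvd N\<close> by (metis dvdE dvd_trans mem_Collect_eq)
    then show "card (?C g) = ?n (M div g)"
      using assms(1) card_gcd_eq_fibre[of g l P d] by simp
  qed
  also have "\<dots> = (\<Sum>d | d dvd M. ?n d)"
    using assms(1) by (intro sum.reindex_bij_witness[of _ "(div) M" "(div) M"]) (auto elim: dvdE)
  finally show ?thesis .
qed

text \<open>The difference of two values of \<open>e \<mapsto> e (k e - s)\<close> is \<open>(e - e') (k (e + e') - s)\<close>, whose second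
  factor is a unit modulo \<open>d\<close>.\<close>

lemma residue_count_quadratic_vimage:
  fixes k s :: int
  assumes "periodic (d ^ j) S" "int d dvd k" "coprime s (int d)"
  shows "residue_count (d ^ j) ((\<lambda>e. e * (k * e - s)) -` S) = residue_count (d ^ j) S"
proof -
  have unit: "coprime (k * x - s) (int (d ^ j))" for x
  proof -
    have "[- s = k * x - s] (mod int d)"
      using assms(2) by (simp add: cong_iff_dvd_diff)
    then have "coprime (k * x - s) (int d)"
      by (rule cong_imp_coprime) (use assms(3) in simp)
    then show ?thesis by simp
  qed
  show ?thesis
    using assms(1)
  proof (rule residue_count_vimage)
    fix x y assume "[x * (k * x - s) = y * (k * y - s)] (mod int (d ^ j))"
    then have "int (d ^ j) dvd x * (k * x - s) - y * (k * y - s)"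
      by (simp only: cong_iff_dvd_diff)
    also have "x * (k * x - s) - y * (k * y - s) = (x - y) * (k * (x + y) - s)"
      by (simp add: algebra_simps)
    finally show "[x = y] (mod int (d ^ j))"
      using unit by (simp add: cong_iff_dvd_diff coprime_dvd_mult_left_iff coprime_commute)
  qed
qed

section \<open>One step of the iteration\<close>

lemma chi_ord_rec: "chi_ord x = (if x \<in> \<int> then 0 else eSuc (chi_ord (chi x)))"
proof (cases "x \<in> \<int>")
  case True
  then have "(LEAST k. (chi ^^ k) x \<in> \<int>) = 0" by (intro Least_eq_0) simp
  moreover have "\<exists>k. (chi ^^ k) x \<in> \<int>" using True by (intro exI[of _ 0]) simp
  ultimately show ?thesis using True by (simp add: chi_ord_def zero_enat_def)
next
  case not_int: False
  have funpow_chi: "(chi ^^ Suc k) x = (chi ^^ k) (chi x)" for k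
    by (simp add: funpow_Suc_right del: funpow.simps)
  show ?thesis
  proof (cases "\<exists>k. (chi ^^ k) (chi x) \<in> \<int>")
    case True
    then obtain k where k: "(chi ^^ Suc k) x \<in> \<int>" unfolding funpow_chi ..
    then have "(LEAST k. (chi ^^ k) x \<in> \<int>) = Suc (LEAST k. (chi ^^ k) (chi x) \<in> \<int>)"
      unfolding funpow_chi[symmetric] by (rule Least_Suc) (simp add: not_int)
    moreover have "\<exists>k. (chi ^^ k) x \<in> \<int>" using k by blast
    ultimately show ?thesis
      using not_int True by (simp add: chi_ord_def eSuc_enat)
  next
    case False
    have "(chi ^^ k) x \<notin> \<int>" for k
      using False not_int by (cases k) (simp_all add: funpow_chi del: funpow.simps(2))
    then show ?thesis
      using False not_int by (simp add: chi_ord_def)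
  qed
qed

lemma coprime_fraction_in_Ints_iff:
  assumes "coprime a (int M)" "M > 0"
  shows "(of_int a / of_nat M :: rat) \<in> \<int> \<longleftrightarrow> M = 1"
proof -
  have "(of_int a / of_nat M :: rat) \<in> \<int> \<longleftrightarrow> int M dvd a"
    using of_int_div_of_int_in_Ints_iff[of a "int M", where 'a = rat] assms(2) by simp
  also have "\<dots> \<longleftrightarrow> M = 1"
    using assms(1) by (auto dest: coprime_common_divisor_int)
  finally show ?thesis .
qed

lemma ord_set_0: "M > 0 \<Longrightarrow> ord_set 0 M = (if M = 1 then UNIV else {})"
  by (auto simp: ord_set_def chi_ord_rec coprime_fraction_in_Ints_iff simp flip: zero_enat_def)

lemma ord_set_Suc_1: "ord_set (Suc n) 1 = {}"
  by (auto simp: ord_set_def chi_ord_rec simp flip: eSuc_enat)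

lemma ceiling_fraction_add_mult:
  assumes "M > 0"
  shows "\<lceil>of_int (a + c * int M) / of_nat M :: rat\<rceil> = \<lceil>of_int a / of_nat M :: rat\<rceil> + c"
proof -
  have "(of_int (a + c * int M) / of_nat M :: rat) = of_int a / of_nat M + of_int c"
    using assms by (simp add: field_simps)
  then show ?thesis by (simp only: ceiling_add_of_int)
qed

lemma ceiling_fraction_mult_diff:
  assumes "s \<in> {0..<int M}"
  shows "\<lceil>of_int (c * int M - s) / of_nat M :: rat\<rceil> = c"
proof -
  have "\<lceil>of_int (- s) / of_nat M :: rat\<rceil> = 0"
    using assms ceiling_divide_eq_div[of "- s" "int M", where 'a = rat] by simp
  then show ?thesis
    using assms ceiling_fraction_add_mult[of M "- s" c] by simp
qed

lemma coprime_mult_diff_iff: "coprime (c * int M - s) (int M) \<longleftrightarrow> coprime s (int M)"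
  using periodicD[OF periodic_coprime, of "c * int M - s" "- s" M]
  by (simp add: cong_iff_dvd_diff)

lemma gcd_factorizationE:
  fixes c :: int
  assumes "M > 0"
  obtains g d e where "M = g * d" "c = int g * e" "coprime e (int d)"
proof -
  define g where "g = nat (gcd c (int M))"
  have g: "int g = gcd c (int M)" by (simp add: g_def)
  have "g dvd M" "int g dvd c" "g > 0"
    using assms by (simp_all add: g nat_dvd_iff g_def)
  then obtain d e where de: "M = g * d" "c = int g * e" by (auto elim!: dvdE)
  have "int g * gcd e (int d) = int g"
    using g de by (simp add: gcd_mult_left)
  then have "coprime e (int d)"
    using \<open>g > 0\<close> by (simp add: coprime_iff_gcd_eq_1)
  then show thesis by (rule that[OF de])
qed

lemma ord_set_Suc_iff:
  assumes M: "M > 1" "M = g * d" and e: "coprime e (int d)"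
    and ceiling: "\<lceil>of_int a / of_nat M :: rat\<rceil> = int g * e"
  shows "a \<in> ord_set (Suc n) M \<longleftrightarrow> coprime a (int M) \<and> e * a \<in> ord_set n d"
proof (cases "coprime a (int M)")
  case True
  have "chi (of_int a / of_nat M) = of_int (e * a) / of_nat d"
    using M unfolding chi_def ceiling by (auto simp: field_simps)
  moreover have "coprime (e * a) (int d)"
    using True e M(2) by simp
  ultimately show ?thesis
    using True M(1) coprime_fraction_in_Ints_iff[OF True]
    by (simp add: ord_set_def chi_ord_rec[of "of_int a / of_nat M"] flip: eSuc_enat)
qed (simp add: ord_set_def)

lemma periodic_ord_set_Suc:
  assumes "M > 1" and periodic: "\<And>d. d > 0 \<Longrightarrow> periodic (d ^ (n + 1)) (ord_set n d)"
  shows "periodic (M ^ (n + 2)) (ord_set (Suc n) M)"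
  unfolding periodic_def
proof (intro allI impI)
  fix a b :: int
  assume cong: "[a = b] (mod int (M ^ (n + 2)))"
  obtain g d e where M: "M = g * d"
    and ceiling_a: "\<lceil>of_int a / of_nat M :: rat\<rceil> = int g * e" and e: "coprime e (int d)"
    by (rule gcd_factorizationE[of M]) (use \<open>M > 1\<close> in simp)
  have "d > 0" using M \<open>M > 1\<close> by (auto intro: Nat.gr0I)
  obtain t where "b = a + int (M ^ (n + 2)) * t"
    using cong by (auto simp: cong_iff_lin)
  then have b: "b = a + (int M ^ (n + 1) * t) * int M" by simp
  define u where "u = e + int (d * M ^ n) * t"
  have "int g * u = int g * e + int M ^ (n + 1) * t"
    by (simp add: u_def M algebra_simps)
  then have ceiling_b: "\<lceil>of_int b / of_nat M :: rat\<rceil> = int g * u"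
    using ceiling_fraction_add_mult[of M] \<open>M > 1\<close> by (simp only: b ceiling_a)
  have "d ^ (n + 1) dvd d * M ^ n"
    by (simp add: M power_mult_distrib)
  then have "int (d ^ (n + 1)) dvd int (d * M ^ n)"
    by (simp only: of_nat_dvd_iff)
  then have cong_e: "[e = u] (mod int (d ^ (n + 1)))"
    by (simp add: u_def cong_iff_dvd_diff del: of_nat_mult of_nat_power)
  then have u: "coprime u (int d)"
    using e cong_dvd_modulus[OF cong_e, of "int d"] cong_imp_coprime by simp
  have "d ^ (n + 1) dvd M ^ (n + 2)"
    using \<open>d ^ (n + 1) dvd d * M ^ n\<close> by (simp add: M power_mult_distrib)
  then have "[a = b] (mod int (d ^ (n + 1)))"
    using cong cong_dvd_modulus of_nat_dvd_iff by blast
  then have "e * a \<in> ord_set n d \<longleftrightarrow> u * b \<in> ord_set n d"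
    by (intro periodicD[OF periodic] cong_mult cong_e \<open>d > 0\<close>)
  moreover have "coprime a (int M) \<longleftrightarrow> coprime b (int M)"
    using periodicD[OF periodic_coprime cong_dvd_modulus[OF cong]] by simp
  ultimately show "a \<in> ord_set (Suc n) M \<longleftrightarrow> b \<in> ord_set (Suc n) M"
    using ord_set_Suc_iff[OF \<open>M > 1\<close> M e ceiling_a] ord_set_Suc_iff[OF \<open>M > 1\<close> M u ceiling_b]
    by simp
qed

lemma periodic_ord_set: "M > 0 \<Longrightarrow> periodic (M ^ (n + 1)) (ord_set n M)"
proof (induction n arbitrary: M)
  case 0
  then show ?case by (simp add: ord_set_0 periodic_def)
next
  case (Suc n)
  show ?case
  proof (cases "M = 1")
    case True
    then show ?thesis using ord_set_Suc_1[of n] by (simp add: periodic_def)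
  next
    case False
    then show ?thesis using periodic_ord_set_Suc[of M n] Suc by simp
  qed
qed

lemma class_count_eq_residue_count:
  "M > 0 \<Longrightarrow> class_count n M = residue_count (M ^ (n + 1)) (ord_set n M)"
  unfolding class_count_def by (intro card_cong_classes_subset periodic_ord_set) simp_all

section \<open>The recurrence\<close>

lemma card_ord_set_Suc_fibre:
  assumes M: "M > 1" "M = g * d" and s: "s \<in> {0..<int M}" "coprime s (int M)"
  shows "card {e \<in> {0..<int (d * M ^ n)}. coprime e (int d) \<and>
    int g * e * int M - s \<in> ord_set (Suc n) M} = g ^ n * class_count n d"
proof -
  have "d > 0" using M by (auto intro: Nat.gr0I)
  let ?f = "\<lambda>e. e * (int g * int M * e - s)"
  have "coprime e (int d) \<and> int g * e * int M - s \<in> ord_set (Suc n) M \<longleftrightarrow> ?f e \<in> ord_set n d" for e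
  proof (cases "coprime e (int d)")
    case True
    then show ?thesis
      using ord_set_Suc_iff[OF M True ceiling_fraction_mult_diff[OF s(1)]]
        coprime_mult_diff_iff[of "int g * e" M s] s(2)
      by (simp add: mult_ac)
  qed (simp add: ord_set_def)
  then have "card {e \<in> {0..<int (d * M ^ n)}. coprime e (int d) \<and>
      int g * e * int M - s \<in> ord_set (Suc n) M} =
      residue_count (d * M ^ n) (?f -` ord_set n d)"
    by (simp add: residue_count_def)
  also have "\<dots> = residue_count (d ^ (n + 1) * g ^ n) (?f -` ord_set n d)"
    by (simp add: M(2) power_mult_distrib mult_ac)
  also have "\<dots> = g ^ n * residue_count (d ^ (n + 1)) (?f -` ord_set n d)"
    using \<open>d > 0\<close>
    by (intro residue_count_mult periodic_vimage periodic_ord_set cong_mult cong_diff cong_refl)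
  also have "residue_count (d ^ (n + 1)) (?f -` ord_set n d) =
      residue_count (d ^ (n + 1)) (ord_set n d)"
    using s(2) \<open>d > 0\<close>
    by (intro residue_count_quadratic_vimage periodic_ord_set) (simp_all add: M(2))
  finally show ?thesis
    by (simp only: class_count_eq_residue_count[OF \<open>d > 0\<close>])
qed

lemma card_ord_set_Suc_block:
  assumes "M > 1" and s: "s \<in> {0..<int M}"
  shows "card {c \<in> {0..<int (M ^ (n + 1))}. c * int M - s \<in> ord_set (Suc n) M} =
    (if coprime s (int M) then \<Sum>d | d dvd M. (M div d) ^ n * class_count n d else 0)"
proof (cases "coprime s (int M)")
  case True
  have "card {c \<in> {0..<int (M ^ (n + 1))}. c * int M - s \<in> ord_set (Suc n) M} =
      (\<Sum>d | d dvd M. card {e \<in> {0..<int (M ^ (n + 1) div (M div d))}.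
        coprime e (int d) \<and> int (M div d) * e * int M - s \<in> ord_set (Suc n) M})"
    using assms(1) by (intro card_eq_sum_gcd) simp_all
  also have "\<dots> = (\<Sum>d | d dvd M. (M div d) ^ n * class_count n d)"
  proof (intro sum.cong refl)
    fix d assume "d \<in> {d. d dvd M}"
    then obtain g where g: "M = g * d" by (metis dvdE mem_Collect_eq mult.commute)
    moreover from this have "g > 0" "d > 0" using assms(1) by (auto intro: Nat.gr0I)
    ultimately have "M div d = g" "M ^ (n + 1) div g = d * M ^ n" by simp_all
    then show "card {e \<in> {0..<int (M ^ (n + 1) div (M div d))}.
        coprime e (int d) \<and> int (M div d) * e * int M - s \<in> ord_set (Suc n) M} =
      (M div d) ^ n * class_count n d"
      using card_ord_set_Suc_fibre[OF assms(1) g s True] by simp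
  qed
  finally show ?thesis using True by simp
next
  case False
  then show ?thesis by (simp add: ord_set_def coprime_mult_diff_iff)
qed

lemma class_count_Suc:
  assumes "M > 1"
  shows "class_count (Suc n) M = totient M * (\<Sum>d | d dvd M. (M div d) ^ n * class_count n d)"
    (is "_ = _ * ?K")
proof -
  have "class_count (Suc n) M = residue_count (M * M ^ (n + 1)) (ord_set (Suc n) M)"
    using assms class_count_eq_residue_count[of M "Suc n"] by simp
  also have "\<dots> = (\<Sum>s = 0..<int M.
      card {c \<in> {0..<int (M ^ (n + 1))}. c * int M - s \<in> ord_set (Suc n) M})"
    using assms periodic_ord_set[of M "Suc n"] by (intro residue_count_eq_sum_blocks) simp
  also have "\<dots> = (\<Sum>s = 0..<int M. if coprime s (int M) then ?K else 0)"
    using assms by (intro sum.cong refl card_ord_set_Suc_block)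
  also have "\<dots> = card {s \<in> {0..<int M}. coprime s (int M)} * ?K"
    by (subst sum.inter_filter[symmetric]) simp_all
  also have "card {s \<in> {0..<int M}. coprime s (int M)} = totient M"
    using residue_count_coprime[of M] by (simp add: residue_count_def)
  finally show ?thesis .
qed

definition ord_prob :: "nat \<Rightarrow> nat \<Rightarrow> real" where
  "ord_prob n M = real (class_count n M) / real (totient (M ^ (n + 1)))"

lemma ord_prob_nonneg: "ord_prob n M \<ge> 0"
  by (simp add: ord_prob_def)

lemma ord_prob_1: "ord_prob n 1 = (if n = 0 then 1 else 0)"
proof (cases n)
  case 0
  then show ?thesis
    by (simp add: ord_prob_def class_count_eq_residue_count residue_count_def ord_set_0
        del: atLeastLessThan_iff)
next
  case (Suc k)
  then show ?thesis
    using ord_set_Suc_1[of k]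
    by (simp add: ord_prob_def class_count_eq_residue_count residue_count_def)
qed

lemma ord_prob_0: "M > 1 \<Longrightarrow> ord_prob 0 M = 0"
  by (simp add: ord_prob_def class_count_eq_residue_count residue_count_def ord_set_0)

lemma ord_prob_Suc:
  assumes "M > 1"
  shows "ord_prob (Suc n) M = (\<Sum>d | d dvd M. real (totient d) / real M * ord_prob n d)"
proof -
  have totient_power: "totient (k ^ (j + 1)) = k ^ j * totient k" for k j
    using totient_power_Suc[of k j] by simp
  have "ord_prob (Suc n) M =
      (\<Sum>d | d dvd M. real ((M div d) ^ n * class_count n d)) / real M ^ (n + 1)"
    using assms unfolding ord_prob_def class_count_Suc[OF assms] totient_power by simp
  also have "\<dots> = (\<Sum>d | d dvd M. real (totient d) / real M * ord_prob n d)"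
    unfolding sum_divide_distrib
  proof (intro sum.cong refl)
    fix d assume "d \<in> {d. d dvd M}"
    then obtain g where g: "M = d * g" by auto
    then have "d > 0" "g > 0" using assms by (auto intro: Nat.gr0I)
    then show "real ((M div d) ^ n * class_count n d) / real M ^ (n + 1) =
        real (totient d) / real M * ord_prob n d"
      unfolding ord_prob_def totient_power by (simp add: g power_mult_distrib field_simps)
  qed
  finally show ?thesis .
qed

section \<open>Absorption\<close>

lemma sums_affine_recurrence:
  fixes p t :: "nat \<Rightarrow> 'a :: {real_normed_field, banach}"
  assumes q: "norm q < 1" and t: "summable (\<lambda>n. norm (t n))"
    and rec: "\<And>n. p (Suc n) = q * p n + t n"
  shows "p sums ((p 0 + suminf t) / (1 - q))"
proof -
  define u where "u = case_nat (p 0) t"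
  have u_norm: "summable (\<lambda>n. norm (u n))"
    using t by (subst summable_Suc_iff[symmetric]) (simp add: u_def)
  have convolution: "(\<Sum>i\<le>n. q ^ i * u (n - i)) = p n" for n
    by (induction n) (simp_all add: u_def rec sum.atMost_Suc_shift sum_distrib_left mult.assoc
        del: sum.atMost_Suc flip: sum_distrib_left)
  have "(\<lambda>n. \<Sum>i\<le>n. q ^ i * u (n - i)) sums ((\<Sum>n. q ^ n) * suminf u)"
    using q u_norm by (intro Cauchy_product_sums) (simp_all add: norm_power summable_geometric)
  moreover have "suminf u = p 0 + suminf t"
    using suminf_split_head[OF summable_norm_cancel[OF u_norm]] by (simp add: u_def)
  ultimately show ?thesis
    using q by (simp add: convolution suminf_geometric)
qed

lemma sums_1_of_first_step:
  fixes p :: "nat \<Rightarrow> 'a \<Rightarrow> real" and w :: "'a \<Rightarrow> real"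
  assumes "finite D" "x \<in> D" and w: "\<And>d. d \<in> D \<Longrightarrow> w d \<ge> 0" "w x < 1" "sum w D = 1"
    and p: "\<And>n d. d \<in> D \<Longrightarrow> p n d \<ge> 0" "p 0 x = 0" "\<And>n. p (Suc n) x = (\<Sum>d\<in>D. w d * p n d)"
    and sums: "\<And>d. d \<in> D \<Longrightarrow> d \<noteq> x \<Longrightarrow> (\<lambda>n. p n d) sums 1"
  shows "(\<lambda>n. p n x) sums 1"
proof -
  define t where "t n = (\<Sum>d\<in>D - {x}. w d * p n d)" for n
  have "t sums (\<Sum>d\<in>D - {x}. w d * 1)"
    unfolding t_def by (intro sums_sum sums_mult sums) auto
  also have "(\<Sum>d\<in>D - {x}. w d * 1) = 1 - w x"
    using assms(1,2) w(3) by (simp add: sum_diff1)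
  finally have t: "t sums (1 - w x)" .
  have "(\<lambda>n. p n x) sums ((p 0 x + suminf t) / (1 - w x))"
  proof (rule sums_affine_recurrence)
    have "t n \<ge> 0" for n unfolding t_def by (intro sum_nonneg mult_nonneg_nonneg w(1) p(1)) auto
    then show "summable (\<lambda>n. norm (t n))" using t by (simp add: sums_iff)
    show "p (Suc n) x = w x * p n x + t n" for n
      unfolding p(3) t_def by (rule sum.remove[OF assms(1,2)])
  qed (use assms(2) w(1)[of x] w(2) in simp)
  then show ?thesis
    using t w(2) p(2) by (simp add: sums_iff)
qed

theorem theorem3p1:
  fixes M :: nat
  assumes "M \<ge> 1"
  shows "(\<lambda>n. real (class_count n M) / real (totient (M ^ (n + 1)))) sums 1"
  unfolding ord_prob_def[symmetric]
  using assms
proof (induction M rule: less_induct)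
  case (less M)
  show ?case
  proof (cases "M = 1")
    case True
    then show ?thesis
      using sums_single[of 0 "\<lambda>_. 1 :: real"] by (simp add: ord_prob_1 del: One_nat_def)
  next
    case False
    then have "M > 1" using less.prems by simp
    show ?thesis
    proof (rule sums_1_of_first_step)
      show "ord_prob (Suc n) M = (\<Sum>d | d dvd M. real (totient d) / real M * ord_prob n d)" for n
        by (rule ord_prob_Suc[OF \<open>M > 1\<close>])
      show "(\<Sum>d | d dvd M. real (totient d) / real M) = 1"
        using totient_divisor_sum[of M] \<open>M > 1\<close> by (simp flip: sum_divide_distrib of_nat_sum)
      show "real (totient M) / real M < 1"
        using totient_less \<open>M > 1\<close> by simp
      show "(\<lambda>n. ord_prob n d) sums 1" if "d \<in> {d. d dvd M}" "d \<noteq> M" for d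
        using that \<open>M > 1\<close> less.IH[of d] dvd_imp_le[of d M] by (cases "d = 0") auto
    qed (use \<open>M > 1\<close> in \<open>simp_all add: ord_prob_nonneg ord_prob_0\<close>)
  qed
qed

end
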